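(* Let $k$ be a field with $\operatorname{char}(k)\neq2,3$. Let $J=ke_0\oplus V\oplus ke_1$ be the reduced spin factor of a non-degenerate anisotropic quadratic space $(k,V,q)$ with base point $u$. Let $X$ be a non-trivial $J$-ternary algebra, with action $\bullet$, skew-symmetric bilinear map $\beta:X\times X\to J$ and trilinear product $\tau$, and let $X_0=\{x\in X\mid e_0\bullet x=x\}$. Assume that $\beta(u\bullet x,x)\neq0$ for all $x\in X_0\setminus\{0\}$. Then $$\beta(v\bullet x,x)\bullet x=v\bullet\bigl(u\bullet(\beta(u\bullet x,x)\bullet x)\bigr)\quad\text{for all }x\in X_0,\ v\in V.$$ Therefore $(k,V,q,u,X_0,\cdot,h)$ is a quadrangular algebra, where $x\cdot v:=v\bullet(u\bullet x)$ and $h(x,y):=\beta(u\bullet x,y)$ for $x,y\in X_0$, $v\in V$.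
   Context: A Jordan $k$-algebra is a unital commutative $k$-algebra with $(x^2y)x=x^2(yx)$; $U_xy:=2x(xy)-x^2y$. Reduced spin factor: for a quadratic form $q:V\to k$ with associated bilinear form $f(v,w)=q(v+w)-q(v)-q(w)$, it is the Jordan algebra $J=ke_0\oplus V\oplus ke_1$ with commutative product $(t_1e_i)(t_2e_j)=\delta_{ij}t_1t_2e_i$, $(te_i)v=\tfrac12tv$, $vw=\tfrac12f(v,w)(e_0+e_1)$ for $i,j\in\{0,1\}$, $t,t_1,t_2\in k$, $v,w\in V$. A base point of $q$ is $u\in V$ with $q(u)=1$. A special $J$-module is a $k$-vector space $X$ with a $k$-bilinear action $\bullet:J\times X\to X$ such that $1\bullet x=x$ and $(U_jj')\bullet x=j\bullet(j'\bullet(j\bullet x))$ for all $j,j'\in J$, $x\in X$. A $J$-ternary algebra ($\operatorname{char}(k)\ne2,3$) is a special $J$-module $X$ with a skew-symmetric bilinear map $\beta:X\times X\to J$ and a trilinear product $\tau:X\times X\times X\to X$ such that for all $j\in J$, $x,y,z,v,w\in X$: - (JT1) $j\,\beta(x,y)=\tfrac12\beta(j\bullet x,y)+\tfrac12\beta(x,j\bullet y)$; - (JT2) $j\bullet\tau(x,y,z)=\tau(j\bullet x,y,z)-\tau(x,j\bullet y,z)+\tau(x,y,j\bullet z)$; - (JT3) $\tau(x,y,z)=\tau(z,y,x)-\beta(x,z)\bullet y$; - (JT4) $\tau(x,y,z)=\tau(y,x,z)+\beta(x,y)\bullet z$; - (JT5) $\beta(\tau(x,y,z),w)+\beta(z,\tau(x,y,w))=\beta(x,\beta(z,w)\bullet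 y)$; - (JT6) $\tau(x,y,\tau(z,w,v))=\tau(\tau(x,y,z),w,v)+\tau(z,\tau(y,x,w),v)+\tau(z,w,\tau(x,y,v))$. A quadrangular algebra (over $k$ with $\operatorname{char}(k)\ne2$) is a 7-tuple $(k,L,q,1,X,\cdot,h)$ with $L$ a $k$-vector space, $q:L\to k$ an anisotropic quadratic form, $1\in L$ with $q(1)=1$, $X$ a nontrivial $k$-vector space, and maps $X\times L\to X:(x,v)\mapsto x\cdot v$ (also written $xv$), $h:X\times X\to L$ such that, with $f(v,w)=q(v+w)-q(v)-q(w)$, $v^\sigma=f(1,v)1-v$, $v^{-1}=v^\sigma/q(v)$, for all $x,y\in X$, $v\in L$: (A1) $\cdot$ is $k$-bilinear; (A2) $x\cdot1=x$; (A3) $(xv)v^{-1}=x$ for $v\ne0$; (B1) $h$ is $k$-bilinear; (B2) $h(x,yv)=h(y,xv)+f(h(x,y),1)v$; (B3) $f(h(xv,y),1)=f(h(x,y),v)$; (C) $\theta(x,v):=\tfrac12h(x,xv)$; (D1) with $\pi(x)=\theta(x,1)$, $x\theta(x,v)=(x\pi(x))v$; (D2) $\pi(x)\ne0$ for $x\ne0$. *)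

theory Defs
  imports
    Complex_Main
    "HOL-Library.Product_Plus"
begin

section \<open>Quadratic forms\<close>

definition polar :: "('v::ab_group_add \<Rightarrow> 'k::ab_group_add) \<Rightarrow> 'v \<Rightarrow> 'v \<Rightarrow> 'k" where
  "polar q v w = q (v + w) - q v - q w"

locale quadratic_form = vector_space scale
  for scale :: "'k::field \<Rightarrow> 'v::ab_group_add \<Rightarrow> 'v" +
  fixes q :: "'v \<Rightarrow> 'k"
  assumes homogeneous: "q (scale t v) = t\<^sup>2 * q v"
    and polar_linear_left: "Vector_Spaces.linear scale (*) (\<lambda>v. polar q v w)"
    and polar_linear_right: "Vector_Spaces.linear scale (*) (\<lambda>w. polar q v w)"

definition anisotropic :: "('v::zero \<Rightarrow> 'k::zero) \<Rightarrow> bool" where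
  "anisotropic q \<longleftrightarrow> (\<forall>v. q v = 0 \<longrightarrow> v = 0)"

definition nondegenerate :: "('v::ab_group_add \<Rightarrow> 'k::ab_group_add) \<Rightarrow> bool" where
  "nondegenerate q \<longleftrightarrow> (\<forall>v. (\<forall>w. polar q v w = 0) \<longrightarrow> v = 0)"


section \<open>Jordan algebras and their special modules\<close>

locale jordan_algebra = vector_space scale
  for scale :: "'k::field \<Rightarrow> 'j::ab_group_add \<Rightarrow> 'j" +
  fixes mult :: "'j \<Rightarrow> 'j \<Rightarrow> 'j"  (infixl \<open>\<diamondop>\<close> 70)
    and unit :: 'j
  assumes mult_linear_left: "Vector_Spaces.linear scale scale (\<lambda>a. a \<diamondop> b)"
    and mult_linear_right: "Vector_Spaces.linear scale scale (\<lambda>b. a \<diamondop> b)"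
    and mult_commute: "a \<diamondop> b = b \<diamondop> a"
    and mult_unit: "unit \<diamondop> a = a"
    and jordan_identity: "((a \<diamondop> a) \<diamondop> b) \<diamondop> a = (a \<diamondop> a) \<diamondop> (b \<diamondop> a)"
begin

definition U :: "'j \<Rightarrow> 'j \<Rightarrow> 'j" where
  "U a b = scale 2 (a \<diamondop> (a \<diamondop> b)) - (a \<diamondop> a) \<diamondop> b"

end

locale special_jordan_module =
  jordan_algebra scaleJ mult unit + X: vector_space scaleX
  for scaleJ :: "'k::field \<Rightarrow> 'j::ab_group_add \<Rightarrow> 'j"
    and mult :: "'j \<Rightarrow> 'j \<Rightarrow> 'j"  (infixl \<open>\<diamondop>\<close> 70)
    and unit :: 'j
    and scaleX :: "'k \<Rightarrow> 'x::ab_group_add \<Rightarrow> 'x" +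
  fixes act :: "'j \<Rightarrow> 'x \<Rightarrow> 'x"  (infixr \<open>\<bullet>\<close> 75)
  assumes act_linear_left: "Vector_Spaces.linear scaleJ scaleX (\<lambda>j. j \<bullet> x)"
    and act_linear_right: "Vector_Spaces.linear scaleX scaleX (\<lambda>x. j \<bullet> x)"
    and act_unit: "unit \<bullet> x = x"
    and act_U: "U j j' \<bullet> x = j \<bullet> (j' \<bullet> (j \<bullet> x))"


section \<open>Ternary algebras over a Jordan algebra\<close>

locale J_ternary_algebra =
  special_jordan_module scaleJ mult unit scaleX act
  for scaleJ :: "'k::field \<Rightarrow> 'j::ab_group_add \<Rightarrow> 'j"
    and mult :: "'j \<Rightarrow> 'j \<Rightarrow> 'j"  (infixl \<open>\<diamondop>\<close> 70)
    and unit :: 'j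
    and scaleX :: "'k \<Rightarrow> 'x::ab_group_add \<Rightarrow> 'x"
    and act :: "'j \<Rightarrow> 'x \<Rightarrow> 'x"  (infixr \<open>\<bullet>\<close> 75) +
  fixes \<beta> :: "'x \<Rightarrow> 'x \<Rightarrow> 'j"
    and \<tau> :: "'x \<Rightarrow> 'x \<Rightarrow> 'x \<Rightarrow> 'x"
  assumes char_not_2: "CHAR('k) \<noteq> 2"
    and char_not_3: "CHAR('k) \<noteq> 3"
    and beta_linear_left: "Vector_Spaces.linear scaleX scaleJ (\<lambda>x. \<beta> x y)"
    and beta_linear_right: "Vector_Spaces.linear scaleX scaleJ (\<lambda>y. \<beta> x y)"
    and beta_skew: "\<beta> x y = - \<beta> y x"
    and tau_linear_1: "Vector_Spaces.linear scaleX scaleX (\<lambda>x. \<tau> x y z)"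
    and tau_linear_2: "Vector_Spaces.linear scaleX scaleX (\<lambda>y. \<tau> x y z)"
    and tau_linear_3: "Vector_Spaces.linear scaleX scaleX (\<lambda>z. \<tau> x y z)"
    and JT1: "j \<diamondop> \<beta> x y = scaleJ (1 / 2) (\<beta> (j \<bullet> x) y) + scaleJ (1 / 2) (\<beta> x (j \<bullet> y))"
    and JT2: "j \<bullet> \<tau> x y z = \<tau> (j \<bullet> x) y z - \<tau> x (j \<bullet> y) z + \<tau> x y (j \<bullet> z)"
    and JT3: "\<tau> x y z = \<tau> z y x - \<beta> x z \<bullet> y"
    and JT4: "\<tau> x y z = \<tau> y x z + \<beta> x y \<bullet> z"
    and JT5: "\<beta> (\<tau> x y z) w + \<beta> z (\<tau> x y w) = \<beta> x (\<beta> z w \<bullet> y)"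
    and JT6: "\<tau> x y (\<tau> z w v) = \<tau> (\<tau> x y z) w v + \<tau> z (\<tau> y x w) v + \<tau> z w (\<tau> x y v)"


section \<open>Reduced spin factors\<close>

text \<open>
  The triple \<open>(a, v, b)\<close> stands for \<open>a e\<^sub>0 + v + b e\<^sub>1\<close>, and \<open>spin_mult\<close> is the bilinear
  extension of the products of the components (see the lemma \<open>spin_mult_components\<close>).
\<close>

type_synonym ('k, 'v) spin = "'k \<times> 'v \<times> 'k"

definition spin_scale :: "('k::times \<Rightarrow> 'v \<Rightarrow> 'v) \<Rightarrow> 'k \<Rightarrow> ('k, 'v) spin \<Rightarrow> ('k, 'v) spin" where
  "spin_scale scale t = (\<lambda>(a, v, b). (t * a, scale t v, t * b))"

definition spin_mult ::
  "('k::field \<Rightarrow> 'v::ab_group_add \<Rightarrow> 'v) \<Rightarrow> ('v \<Rightarrow> 'k) \<Rightarrow>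
    ('k, 'v) spin \<Rightarrow> ('k, 'v) spin \<Rightarrow> ('k, 'v) spin" where
  "spin_mult scale q = (\<lambda>(a, v, b) (a', v', b').
     (a * a' + polar q v v' / 2,
      scale ((a + b) / 2) v' + scale ((a' + b') / 2) v,
      b * b' + polar q v v' / 2))"

definition spin_e0 :: "('k::zero_neq_one, 'v::zero) spin" where
  "spin_e0 = (1, 0, 0)"

definition spin_e1 :: "('k::zero_neq_one, 'v::zero) spin" where
  "spin_e1 = (0, 0, 1)"

definition spin_one :: "('k::field, 'v::ab_group_add) spin" where
  "spin_one = spin_e0 + spin_e1"

definition spin_vec :: "'v \<Rightarrow> ('k::zero, 'v) spin" where
  "spin_vec v = (0, v, 0)"

definition spin_vec_part :: "('k, 'v) spin \<Rightarrow> 'v" where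
  "spin_vec_part = (\<lambda>(a, v, b). v)"

lemma spin_vec_part_spin_vec [simp]: "spin_vec_part (spin_vec v) = v"
  by (simp add: spin_vec_part_def spin_vec_def)

context quadratic_form
begin

lemma polar_simps:
  "polar q (v + v') w = polar q v w + polar q v' w"
  "polar q v (w + w') = polar q v w + polar q v w'"
  "polar q (scale t v) w = t * polar q v w"
  "polar q v (scale t w) = t * polar q v w"
  using polar_linear_left polar_linear_right
  by (simp_all add: linear_iff_module_hom module_hom_iff)

lemma polar_zero: "polar q 0 w = 0" "polar q v 0 = 0"
  using polar_simps(3)[of 0 0 w] polar_simps(4)[of v 0 0] by simp_all

lemma polar_commute: "polar q v w = polar q w v"
  by (simp add: polar_def add.commute)

lemma spin_mult_components:
  "spin_mult scale q (spin_scale scale t spin_e0) (spin_scale scale t' spin_e0)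
     = spin_scale scale (t * t') spin_e0"
  "spin_mult scale q (spin_scale scale t spin_e1) (spin_scale scale t' spin_e1)
     = spin_scale scale (t * t') spin_e1"
  "spin_mult scale q (spin_scale scale t spin_e0) (spin_scale scale t' spin_e1) = 0"
  "spin_mult scale q (spin_scale scale t spin_e0) (spin_vec v) = spin_vec (scale (t / 2) v)"
  "spin_mult scale q (spin_scale scale t spin_e1) (spin_vec v) = spin_vec (scale (t / 2) v)"
  "spin_mult scale q (spin_vec v) (spin_vec w) = spin_scale scale (polar q v w / 2) spin_one"
  by (simp_all add: spin_mult_def spin_scale_def spin_e0_def spin_e1_def spin_one_def spin_vec_def
      polar_zero zero_prod_def)

lemma vector_space_spin: "vector_space (spin_scale scale)"
  by unfold_locales (auto simp: spin_scale_def algebra_simps)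

lemma spin_mult_commute: "spin_mult scale q a b = spin_mult scale q b a"
  by (auto simp: spin_mult_def polar_commute algebra_simps split: prod.splits)

lemma spin_mult_linear_right:
  "spin_mult scale q a (b + c) = spin_mult scale q a b + spin_mult scale q a c"
  "spin_mult scale q a (spin_scale scale t b) = spin_scale scale t (spin_mult scale q a b)"
  by (auto simp: spin_mult_def spin_scale_def polar_simps algebra_simps add_divide_distrib
      split: prod.splits)

lemma spin_mult_linear_left:
  "spin_mult scale q (b + c) a = spin_mult scale q b a + spin_mult scale q c a"
  "spin_mult scale q (spin_scale scale t b) a = spin_scale scale t (spin_mult scale q b a)"
  by (simp_all only: spin_mult_commute[of _ a] spin_mult_linear_right)

lemma jordan_algebra_spin:
  assumes "CHAR('k) \<noteq> 2"
  shows "jordan_algebra (spin_scale scale) (spin_mult scale q) spin_one"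
proof -
  have two: "(2::'k) \<noteq> 0"
  proof
    assume "(2::'k) = 0"
    then have "CHAR('k) dvd 2"
      using of_nat_eq_0_iff_char_dvd[where 'a='k, of 2] by simp
    then have "CHAR('k) \<noteq> 0" and "CHAR('k) \<le> 2"
      by (metis dvd_0_left zero_neq_numeral, simp add: dvd_imp_le)
    with assms have "CHAR('k) = 1"
      by linarith
    then show False
      using of_nat_CHAR[where 'a='k] by simp
  qed
  interpret S: vector_space "spin_scale scale"
    by (rule vector_space_spin)
  have unit: "spin_mult scale q spin_one a = a" for a
    using two
    by (auto simp: spin_mult_def spin_one_def spin_e0_def spin_e1_def polar_zero split: prod.splits)
  have half: "polar q v v / 2 = q v" for v
    using two homogeneous[of 2 v] scale_left_distrib[of 1 1 v]
    by (simp add: polar_def field_simps power2_eq_square)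
  have quadratic: "\<exists>t n. spin_mult scale q a a = spin_scale scale t a + spin_scale scale n spin_one" for a
  proof -
    obtain a0 v a1 where a: "a = (a0, v, a1)"
      by (cases a) auto
    have "scale ((a0 + a1) / 2) v + scale ((a0 + a1) / 2) v = scale (a0 + a1) v"
      unfolding scale_left_distrib[symmetric] using two by (simp add: add_divide_distrib[symmetric])
    then have "spin_mult scale q a a =
        spin_scale scale (a0 + a1) a + spin_scale scale (q v - a0 * a1) spin_one"
      by (simp add: a spin_mult_def spin_scale_def spin_one_def spin_e0_def spin_e1_def half
          algebra_simps)
    then show ?thesis by blast
  qed
  have linear: "Vector_Spaces.linear (spin_scale scale) (spin_scale scale) (\<lambda>b. spin_mult scale q a b)" for a
    by unfold_locales (rule spin_mult_linear_right)+
  show ?thesis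
  proof (intro jordan_algebra.intro jordan_algebra_axioms.intro)
    fix a b
    show "Vector_Spaces.linear (spin_scale scale) (spin_scale scale) (\<lambda>a. spin_mult scale q a b)"
      using linear[of b] by (subst spin_mult_commute)
    show "spin_mult scale q (spin_mult scale q (spin_mult scale q a a) b) a =
        spin_mult scale q (spin_mult scale q a a) (spin_mult scale q b a)"
    proof -
      obtain t n where "spin_mult scale q a a = spin_scale scale t a + spin_scale scale n spin_one"
        using quadratic by blast
      moreover have "spin_mult scale q (spin_mult scale q a b) a = spin_mult scale q a (spin_mult scale q b a)"
        by (metis spin_mult_commute)
      ultimately show ?thesis
        by (simp only: spin_mult_linear_left unit)
    qed
  qed (fact vector_space_spin linear unit spin_mult_commute)+
qed

end


section \<open>Quadrangular algebras\<close>

text \<open>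
  The space \<open>L\<close> is a whole type, whereas \<open>X\<close> is a subspace of an ambient vector space, so that
  \<open>act\<close> and \<open>h\<close> only matter for arguments in \<open>X\<close>.  The locale parameter \<open>one\<close> is the base point.
\<close>

definition base_conj ::
  "('k::field \<Rightarrow> 'l::ab_group_add \<Rightarrow> 'l) \<Rightarrow> ('l \<Rightarrow> 'k) \<Rightarrow> 'l \<Rightarrow> 'l \<Rightarrow> 'l" where
  "base_conj scale q one v = scale (polar q one v) one - v"

definition base_inverse ::
  "('k::field \<Rightarrow> 'l::ab_group_add \<Rightarrow> 'l) \<Rightarrow> ('l \<Rightarrow> 'k) \<Rightarrow> 'l \<Rightarrow> 'l \<Rightarrow> 'l" where
  "base_inverse scale q one v = scale (1 / q v) (base_conj scale q one v)"

definition linear_on ::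
  "('k::field \<Rightarrow> 'a::ab_group_add \<Rightarrow> 'a) \<Rightarrow> 'a set \<Rightarrow> ('k \<Rightarrow> 'b::ab_group_add \<Rightarrow> 'b) \<Rightarrow>
    ('a \<Rightarrow> 'b) \<Rightarrow> bool" where
  "linear_on scaleA A scaleB f \<longleftrightarrow>
     (\<forall>x\<in>A. \<forall>y\<in>A. f (x + y) = f x + f y) \<and> (\<forall>t. \<forall>x\<in>A. f (scaleA t x) = scaleB t (f x))"

definition qa_theta ::
  "('k::field \<Rightarrow> 'l \<Rightarrow> 'l) \<Rightarrow> ('x \<Rightarrow> 'l \<Rightarrow> 'x) \<Rightarrow> ('x \<Rightarrow> 'x \<Rightarrow> 'l) \<Rightarrow> 'x \<Rightarrow> 'l \<Rightarrow> 'l" where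
  "qa_theta scale act h x v = scale (1 / 2) (h x (act x v))"

definition qa_pi ::
  "('k::field \<Rightarrow> 'l \<Rightarrow> 'l) \<Rightarrow> 'l \<Rightarrow> ('x \<Rightarrow> 'l \<Rightarrow> 'x) \<Rightarrow> ('x \<Rightarrow> 'x \<Rightarrow> 'l) \<Rightarrow> 'x \<Rightarrow> 'l" where
  "qa_pi scale one act h x = qa_theta scale act h x one"

locale quadrangular_algebra =
  quadratic_form scaleL q + X: vector_space scaleX
  for scaleL :: "'k::field \<Rightarrow> 'l::ab_group_add \<Rightarrow> 'l"
    and q :: "'l \<Rightarrow> 'k"
    and one :: 'l
    and scaleX :: "'k \<Rightarrow> 'x::ab_group_add \<Rightarrow> 'x"
    and X :: "'x set"
    and act :: "'x \<Rightarrow> 'l \<Rightarrow> 'x"  (infixl \<open>\<cdot>\<close> 75)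
    and h :: "'x \<Rightarrow> 'x \<Rightarrow> 'l" +
  assumes char_not_2: "CHAR('k) \<noteq> 2"
    and q_anisotropic: "anisotropic q"
    and q_one: "q one = 1"
    and X_subspace: "X.subspace X"
    and X_nontrivial: "X \<noteq> {0}"
    and act_closed: "x \<in> X \<Longrightarrow> x \<cdot> v \<in> X"
    and A1_left: "linear_on scaleX X scaleX (\<lambda>x. x \<cdot> v)"
    and A1_right: "x \<in> X \<Longrightarrow> linear_on scaleL UNIV scaleX (\<lambda>v. x \<cdot> v)"
    and A2: "x \<in> X \<Longrightarrow> x \<cdot> one = x"
    and A3: "x \<in> X \<Longrightarrow> v \<noteq> 0 \<Longrightarrow> (x \<cdot> v) \<cdot> base_inverse scaleL q one v = x"
    and B1_left: "y \<in> X \<Longrightarrow> linear_on scaleX X scaleL (\<lambda>x. h x y)"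
    and B1_right: "x \<in> X \<Longrightarrow> linear_on scaleX X scaleL (\<lambda>y. h x y)"
    and B2: "x \<in> X \<Longrightarrow> y \<in> X \<Longrightarrow>
      h x (y \<cdot> v) = h y (x \<cdot> v) + scaleL (polar q (h x y) one) v"
    and B3: "x \<in> X \<Longrightarrow> y \<in> X \<Longrightarrow> polar q (h (x \<cdot> v) y) one = polar q (h x y) v"
    and D1: "x \<in> X \<Longrightarrow> x \<cdot> qa_theta scaleL (\<cdot>) h x v = (x \<cdot> qa_pi scaleL one (\<cdot>) h x) \<cdot> v"
    and D2: "x \<in> X \<Longrightarrow> x \<noteq> 0 \<Longrightarrow> qa_pi scaleL one (\<cdot>) h x \<noteq> 0"

end

theory Submission
  imports Defs "HOL-Computational_Algebra.Primes"
begin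

text \<open>
  If \<open>e \<bullet> x = x\<close>, \<open>e \<bullet> y = 0\<close> and \<open>e \<bullet> z = z\<close>, then by (JT2) the idempotent \<open>e\<close> acts on
  \<open>\<tau> x y z\<close> with eigenvalue 2, so \<open>\<tau> x y z = 0\<close>.  Together with (JT3) and (JT4) this determines
  the mixed products, and (JT2) for \<open>v \<in> V\<close> becomes \<open>v \<bullet> \<tau> x x x = 3 (\<beta> (v \<bullet> x) x \<bullet> x)\<close> for \<open>x\<close>
  in a Peirce component.  Comparing \<open>v\<close> with \<open>u\<close>, whose action is an involution, gives the
  displayed identity, and (D1) is the same identity for \<open>u \<bullet> x\<close> in the other Peirce component.
  The axioms (B2) and (B3) are components of (JT1) for elements of \<open>V\<close>.
\<close>

text \<open>A characteristic dividing the prime \<open>p\<close> is 1 or \<open>p\<close>, and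
  characteristic 1 would force 1 = 0.\<close>

lemma of_nat_prime_neq_zero:
  assumes "prime p" and "CHAR('k::field) \<noteq> p"
  shows "(of_nat p :: 'k) \<noteq> 0"
  using assms of_nat_CHAR[where 'a='k] by (auto simp: of_nat_eq_0_iff_char_dvd prime_nat_iff)

section \<open>Operator identities in a special Jordan module\<close>

context special_jordan_module
begin

lemma act_simps:
  "(j + j') \<bullet> x = j \<bullet> x + j' \<bullet> x"
  "j \<bullet> (x + y) = j \<bullet> x + j \<bullet> y"
  "scaleJ t j \<bullet> x = scaleX t (j \<bullet> x)"
  "j \<bullet> scaleX t x = scaleX t (j \<bullet> x)"
  using act_linear_left act_linear_right
  by (simp_all add: linear_iff_module_hom module_hom_iff)

lemma act_zero: "0 \<bullet> x = 0" "j \<bullet> 0 = 0"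
  using act_simps(3)[of 0 0 x] act_simps(4)[of j 0 0] by simp_all

lemma act_minus: "(- j) \<bullet> x = - (j \<bullet> x)" "j \<bullet> (- x) = - (j \<bullet> x)"
  using act_simps(1)[of j "- j" x] act_simps(2)[of j x "- x"]
  by (simp_all add: act_zero eq_neg_iff_add_eq_0 add.commute)

lemma act_diff: "(j - j') \<bullet> x = j \<bullet> x - j' \<bullet> x" "j \<bullet> (x - y) = j \<bullet> x - j \<bullet> y"
  using act_simps(1)[of j "- j'" x] act_simps(2)[of j x "- y"] by (simp_all add: act_minus)

text \<open>The operator \<open>U j\<close> sends the unit to the square of \<open>j\<close>, so
  this is \<open>act_U\<close> with the unit in the middle.\<close>

lemma act_square: "(j \<diamondop> j) \<bullet> x = j \<bullet> (j \<bullet> x)"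
proof -
  have "U j unit = j \<diamondop> j"
    using scale_left_distrib[of 1 1 "j \<diamondop> j"]
    by (simp add: U_def mult_commute[of _ unit] mult_unit)
  then show ?thesis
    using act_U[of j unit x] by (simp add: act_unit)
qed

text \<open>Polarisation of \<open>act_square\<close>.\<close>

lemma act_anticommutator: "scaleX 2 ((j \<diamondop> k) \<bullet> x) = j \<bullet> (k \<bullet> x) + k \<bullet> (j \<bullet> x)"
proof -
  have "(j + k) \<diamondop> (j + k) = j \<diamondop> j + j \<diamondop> k + (k \<diamondop> k + j \<diamondop> k)"
    using mult_linear_left mult_linear_right
    by (simp add: linear_iff_module_hom module_hom_iff mult_commute[of k j])
  then show ?thesis
    using act_square[of "j + k" x] X.scale_left_distrib[of 1 1 "(j \<diamondop> k) \<bullet> x"]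
    by (simp add: act_simps act_square algebra_simps)
qed

end

section \<open>Peirce components of a J-ternary algebra for an idempotent\<close>

context J_ternary_algebra
begin

lemma two_neq_zero: "(2::'k) \<noteq> 0" and three_neq_zero: "(3::'k) \<noteq> 0"
  using of_nat_prime_neq_zero[OF two_is_prime_nat char_not_2]
    of_nat_prime_neq_zero[OF _ char_not_3] by simp_all

lemma two_neq_one: "(2::'k) \<noteq> 1"
  by (metis add_cancel_left_left one_add_one zero_neq_one)

text \<open>The anticommutator of \<open>e\<close> and \<open>v\<close> is \<open>v\<close> as an
  operator. Hence, when \<open>e\<close> is idempotent, \<open>v\<close> interchanges the
  eigenspaces of \<open>e\<close> for 0 and 1.\<close>

lemma act_half_Peirce:
  assumes "e \<diamondop> v = scaleJ (1 / 2) v"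
  shows "e \<bullet> (v \<bullet> x) = v \<bullet> x - v \<bullet> (e \<bullet> x)"
  using act_anticommutator[of e v x] two_neq_zero by (simp add: assms act_simps algebra_simps)

lemma JT1_doubled: "scaleJ 2 (j \<diamondop> \<beta> x y) = \<beta> (j \<bullet> x) y + \<beta> x (j \<bullet> y)"
  using two_neq_zero by (simp add: JT1 scale_right_distrib)

lemma beta_simps:
  "\<beta> (x + x') y = \<beta> x y + \<beta> x' y"
  "\<beta> x (y + y') = \<beta> x y + \<beta> x y'"
  "\<beta> (scaleX t x) y = scaleJ t (\<beta> x y)"
  "\<beta> x (scaleX t y) = scaleJ t (\<beta> x y)"
  using beta_linear_left beta_linear_right
  by (simp_all add: linear_iff_module_hom module_hom_iff)

lemma tau_zero: "\<tau> x 0 z = 0"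
  using tau_linear_2[of x z] by (auto simp: linear_iff_module_hom dest: module_hom.zero)

lemma beta_zero: "\<beta> 0 y = 0" "\<beta> x 0 = 0"
  using beta_simps(3)[of 0 0 y] beta_simps(4)[of x 0 0] by simp_all

context
  fixes e
  assumes idempotent: "e \<diamondop> e = e"
begin

lemma tau_Peirce_zero:
  assumes "e \<bullet> x = x" and "e \<bullet> y = 0" and "e \<bullet> z = z"
  shows "\<tau> x y z = 0"
proof -
  let ?t = "\<tau> x y z"
  have e: "e \<bullet> ?t = scaleX 2 ?t"
    using JT2[of e x y z] X.scale_left_distrib[of 1 1 ?t] by (simp add: assms tau_zero)
  \<comment> \<open>The idempotent acts as an idempotent operator, so an eigenvector for 2 satisfies
    4t = 2t.\<close>
  have "scaleX 2 (scaleX 2 ?t) = scaleX 2 ?t"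
    using act_square[of e ?t] by (simp only: idempotent e act_simps)
  then have "scaleX 2 ?t = scaleX 1 ?t"
    using two_neq_zero by (metis X.scale_left_imp_eq X.scale_one)
  then show ?thesis
    using X.scale_right_imp_eq[of ?t 2 1] two_neq_one by blast
qed

text \<open>The three terms of (JT2) are \<open>?b\<close>, 0 and twice \<open>?b\<close>: since
  \<open>v\<close> moves \<open>x\<close> into the 0-eigenspace of \<open>e\<close>, the middle term
  vanishes, and (JT4) and (JT3) then give the outer ones.\<close>

lemma act_tau_Peirce:
  assumes v: "e \<diamondop> v = scaleJ (1 / 2) v" and x: "e \<bullet> x = x"
  shows "v \<bullet> \<tau> x x x = scaleX 3 (\<beta> (v \<bullet> x) x \<bullet> x)"
proof -
  let ?b = "\<beta> (v \<bullet> x) x \<bullet> x"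
  have "\<tau> x (v \<bullet> x) x = 0"
    by (rule tau_Peirce_zero) (simp_all add: act_half_Peirce[OF v] x)
  moreover from this have "\<tau> (v \<bullet> x) x x = ?b"
    using JT4[of "v \<bullet> x" x x] by simp
  moreover from this have "\<tau> x x (v \<bullet> x) = ?b + ?b"
    using JT3[of "v \<bullet> x" x x] by (simp add: algebra_simps)
  ultimately have "v \<bullet> \<tau> x x x = ?b + (?b + ?b)"
    using JT2[of v x x x] by simp
  also have "\<dots> = scaleX 3 ?b"
    using X.scale_left_distrib[of 1 2 ?b] X.scale_left_distrib[of 1 1 ?b] by simp
  finally show ?thesis .
qed

text \<open>As \<open>w\<close> acts as an involution, its instance of \<open>act_tau_Peirce\<close>
  can be solved for \<open>\<tau> x x x\<close>. Substitution into the instance for \<open>v\<close>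
  leaves a common factor 3. The idempotent stays arbitrary so that both \<open>spin_e0\<close> and
  \<open>spin_e1\<close> can be inserted.\<close>

lemma beta_act_Peirce:
  assumes "e \<diamondop> v = scaleJ (1 / 2) v" and "e \<diamondop> w = scaleJ (1 / 2) w"
    and "e \<bullet> x = x" and "w \<diamondop> w = unit"
  shows "\<beta> (v \<bullet> x) x \<bullet> x = v \<bullet> (w \<bullet> (\<beta> (w \<bullet> x) x \<bullet> x))"
proof -
  have "\<tau> x x x = w \<bullet> (w \<bullet> \<tau> x x x)"
    using act_square[of w "\<tau> x x x"] by (simp add: assms act_unit)
  then have "\<tau> x x x = scaleX 3 (w \<bullet> (\<beta> (w \<bullet> x) x \<bullet> x))"
    by (simp add: act_tau_Peirce assms act_simps)
  then have "v \<bullet> \<tau> x x x = scaleX 3 (v \<bullet> (w \<bullet> (\<beta> (w \<bullet> x) x \<bullet> x)))"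
    by (simp add: act_simps)
  then have "scaleX 3 (\<beta> (v \<bullet> x) x \<bullet> x) = scaleX 3 (v \<bullet> (w \<bullet> (\<beta> (w \<bullet> x) x \<bullet> x)))"
    by (simp only: act_tau_Peirce[OF assms(1,3)])
  then show ?thesis
    using three_neq_zero by simp
qed

end

end

section \<open>The reduced spin factor and the Clifford relations on \<open>X\<close>\<close>

locale spin_ternary_algebra =
  Q: quadratic_form scaleV q +
  J_ternary_algebra "spin_scale scaleV" "spin_mult scaleV q" spin_one scaleX act \<beta> \<tau>
  for scaleV :: "'k::field \<Rightarrow> 'v::ab_group_add \<Rightarrow> 'v"
    and q :: "'v \<Rightarrow> 'k"
    and scaleX :: "'k \<Rightarrow> 'x::ab_group_add \<Rightarrow> 'x"
    and act :: "('k, 'v) spin \<Rightarrow> 'x \<Rightarrow> 'x"  (infixr \<open>\<bullet>\<close> 75)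
    and \<beta> :: "'x \<Rightarrow> 'x \<Rightarrow> ('k, 'v) spin"
    and \<tau> :: "'x \<Rightarrow> 'x \<Rightarrow> 'x \<Rightarrow> 'x" +
  fixes u :: 'v
  assumes anisotropic: "anisotropic q"
    and base_point: "q u = 1"
begin

lemma polar_self: "polar q v v = 2 * q v"
proof -
  have "scaleV 2 v = v + v"
    using Q.scale_left_distrib[of 1 1 v] by simp
  then show ?thesis
    using Q.homogeneous[of 2 v] by (simp add: polar_def power2_eq_square)
qed

lemma spin_mult_idempotent:
  "spin_mult scaleV q spin_e0 spin_e0 = spin_e0"
  "spin_mult scaleV q spin_e1 spin_e1 = spin_e1"
  by (simp_all add: spin_mult_def spin_e0_def spin_e1_def Q.polar_zero)

lemma spin_mult_half:
  "spin_mult scaleV q spin_e0 (spin_vec v) = spin_scale scaleV (1 / 2) (spin_vec v)"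
  "spin_mult scaleV q spin_e1 (spin_vec v) = spin_scale scaleV (1 / 2) (spin_vec v)"
  by (simp_all add: spin_mult_def spin_e0_def spin_e1_def spin_vec_def spin_scale_def Q.polar_zero)

lemma spin_mult_vec_self:
  "spin_mult scaleV q (spin_vec v) (spin_vec v) = spin_scale scaleV (q v) spin_one"
  using two_neq_zero by (simp add: Q.spin_mult_components polar_self)

lemma spin_mult_base: "spin_mult scaleV q (spin_vec u) (spin_vec u) = spin_one"
  by (simp add: spin_mult_vec_self base_point)

lemma act_e1: "spin_e1 \<bullet> x = x - spin_e0 \<bullet> x"
  using act_unit[of x] by (simp add: spin_one_def act_simps algebra_simps)

text \<open>This is the defining relation of the Clifford algebra of \<open>q\<close>, of which
  \<open>X\<close> is thus a module; \<open>act_vec_commute\<close> is its polarisation.\<close>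

lemma act_vec_vec: "spin_vec v \<bullet> (spin_vec v \<bullet> x) = scaleX (q v) x"
  using act_square[of "spin_vec v" x] by (simp add: spin_mult_vec_self act_simps act_unit)

lemma act_base_base [simp]: "spin_vec u \<bullet> (spin_vec u \<bullet> x) = x"
  by (simp add: act_vec_vec base_point)

lemma act_vec_commute:
  "spin_vec v \<bullet> (spin_vec w \<bullet> x) = scaleX (polar q v w) x - spin_vec w \<bullet> (spin_vec v \<bullet> x)"
  using act_anticommutator[of "spin_vec v" "spin_vec w" x] two_neq_zero
  by (simp add: Q.spin_mult_components act_simps act_unit algebra_simps)

lemma act_e0_vec: "spin_e0 \<bullet> (spin_vec v \<bullet> x) = spin_vec v \<bullet> x - spin_vec v \<bullet> (spin_e0 \<bullet> x)"
  by (rule act_half_Peirce) (rule spin_mult_half)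

lemma spin_vec_simps:
  "spin_vec (v + w) = (spin_vec v + spin_vec w :: ('k, 'v) spin)"
  "spin_vec (v - w) = (spin_vec v - spin_vec w :: ('k, 'v) spin)"
  "spin_vec (scaleV t v) = spin_scale scaleV t (spin_vec v)"
  by (simp_all add: spin_vec_def spin_scale_def)

lemma spin_vec_part_linear:
  "spin_vec_part (a + b :: ('k, 'v) spin) = spin_vec_part a + spin_vec_part b"
  "spin_vec_part (spin_scale scaleV t a) = scaleV t (spin_vec_part a)"
  by (auto simp: spin_vec_part_def spin_scale_def split: prod.splits)

section \<open>The operations on the Peirce component \<open>X0\<close>\<close>

abbreviation X0 :: "'x set" where "X0 \<equiv> {x. spin_e0 \<bullet> x = x}"

abbreviation right_act :: "'x \<Rightarrow> 'v \<Rightarrow> 'x"  (infixl \<open>\<cdot>\<close> 75) where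
  "x \<cdot> v \<equiv> spin_vec v \<bullet> (spin_vec u \<bullet> x)"

text \<open>For \<open>x\<close> and \<open>y\<close> in \<open>X0\<close>, the base point moves
  \<open>x\<close> to the other Peirce component, which forces the value of \<open>\<beta>\<close>
  into \<open>V\<close>. Taking the vector part then loses nothing
  (\<open>beta_base\<close>).\<close>

abbreviation h :: "'x \<Rightarrow> 'x \<Rightarrow> 'v" where
  "h x y \<equiv> spin_vec_part (\<beta> (spin_vec u \<bullet> x) y)"

lemma subspace_X0: "X.subspace X0"
  by (simp add: X.subspace_def act_simps act_zero)

lemma X0_closed: "x \<in> X0 \<Longrightarrow> x \<cdot> v \<in> X0"
  by (simp add: act_e0_vec act_zero)

text \<open>The idempotent \<open>spin_e0\<close> projects \<open>X\<close> onto \<open>X0\<close>,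
  and the involution \<open>u\<close> carries the complementary component onto \<open>X0\<close>. If
  \<open>X0\<close> were zero, both components would vanish.\<close>

lemma X0_nontrivial:
  assumes "(UNIV :: 'x set) \<noteq> {0}"
  shows "X0 \<noteq> {0}"
proof
  assume X0: "X0 = {0}"
  have "x = 0" for x :: 'x
  proof -
    have "spin_e0 \<bullet> x \<in> X0"
      using act_square[of spin_e0 x] by (simp add: spin_mult_idempotent)
    then have e0: "spin_e0 \<bullet> x = 0"
      using X0 by blast
    then have "spin_vec u \<bullet> x \<in> X0"
      by (simp add: act_e0_vec act_zero)
    then have "spin_vec u \<bullet> x = 0"
      using X0 by blast
    then show "x = 0"
      using act_base_base[of x] by (simp add: act_zero)
  qed
  then show False
    using assms by auto
qed

lemma beta_act_X0:
  assumes "x \<in> X0"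
  shows "\<beta> (spin_vec v \<bullet> x) x \<bullet> x = spin_vec v \<bullet> (spin_vec u \<bullet> (\<beta> (spin_vec u \<bullet> x) x \<bullet> x))"
  using assms by (intro beta_act_Peirce[of spin_e0])
    (simp_all add: spin_mult_idempotent spin_mult_half spin_mult_base)

lemma beta_act_X1:
  assumes "spin_e0 \<bullet> x = 0"
  shows "\<beta> (spin_vec v \<bullet> x) x \<bullet> x = spin_vec v \<bullet> (spin_vec u \<bullet> (\<beta> (spin_vec u \<bullet> x) x \<bullet> x))"
  using assms by (intro beta_act_Peirce[of spin_e1])
    (simp_all add: spin_mult_idempotent spin_mult_half spin_mult_base act_e1)

section \<open>Coordinates of \<open>\<beta>\<close> on pairs of Peirce components\<close>

lemma beta_X1_X0:
  assumes "spin_e0 \<bullet> x = 0" and "spin_e0 \<bullet> y = y"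
  shows "\<beta> x y = spin_vec (spin_vec_part (\<beta> x y))"
proof -
  obtain a v b where b: "\<beta> x y = (a, v, b)"
    by (cases "\<beta> x y") auto
  \<comment> \<open>By (JT1) the value lies in the half-eigenspace of multiplication by
    \<open>spin_e0\<close>, which is \<open>V\<close>.\<close>
  have "spin_scale scaleV 2 (spin_mult scaleV q spin_e0 (\<beta> x y)) = \<beta> x y"
    by (simp add: JT1_doubled assms beta_zero)
  then show ?thesis
    using two_neq_zero two_neq_one
    by (simp add: b spin_mult_def spin_scale_def spin_e0_def spin_vec_def spin_vec_part_def Q.polar_zero)
qed

lemma beta_X1_X1:
  assumes "spin_e0 \<bullet> x = 0" and "spin_e0 \<bullet> y = 0"
  shows "\<exists>s. \<beta> x y = (0, 0, s)"
proof -
  obtain a v b where b: "\<beta> x y = (a, v, b)"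
    by (cases "\<beta> x y") auto
  have "spin_scale scaleV 2 (spin_mult scaleV q spin_e0 (\<beta> x y)) = 0"
    by (simp add: JT1_doubled assms beta_zero)
  then show ?thesis
    using two_neq_zero
    by (simp add: b spin_mult_def spin_scale_def spin_e0_def Q.polar_zero zero_prod_def)
qed

lemma base_X1: "x \<in> X0 \<Longrightarrow> spin_e0 \<bullet> (spin_vec u \<bullet> x) = 0"
  by (simp add: act_e0_vec)

lemma beta_base: "x \<in> X0 \<Longrightarrow> y \<in> X0 \<Longrightarrow> \<beta> (spin_vec u \<bullet> x) y = spin_vec (h x y)"
  by (rule beta_X1_X0) (simp_all add: base_X1)

text \<open>The left side is twice the product of \<open>v\<close> and \<open>h x y\<close> in
  \<open>V\<close>. On the right, the first summand has both arguments in \<open>X0\<close> and the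
  second both in the other component, so one has no \<open>spin_e1\<close> coordinate and the other
  no \<open>spin_e0\<close> coordinate. Each coordinate thus isolates one summand.\<close>

lemma JT1_vec:
  assumes "x \<in> X0" and "y \<in> X0"
  shows "(polar q v (h x y), 0, polar q v (h x y)) =
    \<beta> (x \<cdot> v) y + \<beta> (spin_vec u \<bullet> x) (spin_vec v \<bullet> y)"
proof -
  have "spin_scale scaleV 2 (spin_mult scaleV q (spin_vec v) (\<beta> (spin_vec u \<bullet> x) y)) =
      (polar q v (h x y), 0, polar q v (h x y))"
    using two_neq_zero
    by (subst beta_base[OF assms]) (simp add: spin_mult_def spin_scale_def spin_vec_def)
  then show ?thesis
    by (simp add: JT1_doubled)
qed

lemma fst_beta_act:
  assumes "x \<in> X0" and "y \<in> X0"
  shows "fst (\<beta> (x \<cdot> v) y) = polar q v (h x y)"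
proof -
  obtain s where "\<beta> (spin_vec u \<bullet> x) (spin_vec v \<bullet> y) = (0, 0, s)"
    using beta_X1_X1[of "spin_vec u \<bullet> x" "spin_vec v \<bullet> y"] assms by (auto simp: act_e0_vec)
  then show ?thesis
    using arg_cong[OF JT1_vec[OF assms, of v], of fst] by simp
qed

lemma snd_snd_beta_X0:
  assumes "x \<in> X0" and "y \<in> X0"
  shows "snd (snd (\<beta> x y)) = 0"
proof -
  obtain a v b where b: "\<beta> x y = (a, v, b)"
    by (cases "\<beta> x y") auto
  have "spin_scale scaleV 2 (spin_mult scaleV q spin_e0 (\<beta> x y)) = \<beta> x y + \<beta> x y"
    using assms by (simp add: JT1_doubled)
  then have "b + b = 0"
    by (simp add: b spin_mult_def spin_scale_def spin_e0_def Q.polar_zero)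
  then show ?thesis
    using two_neq_zero by (simp add: b mult_2[symmetric])
qed

section \<open>The axioms of a quadrangular algebra\<close>

lemma h_act_commute:
  assumes "x \<in> X0" and "y \<in> X0"
  shows "h x (y \<cdot> v) = h y (x \<cdot> v) + scaleV (polar q (h x y) u) v"
proof -
  let ?x = "spin_vec u \<bullet> x" and ?y = "spin_vec u \<bullet> y"
  obtain s where s: "\<beta> ?x ?y = (0, 0, s)"
    using beta_X1_X1[of ?x ?y] assms by (auto simp: act_e0_vec)
  \<comment> \<open>For \<open>v = u\<close> the first summand of \<open>JT1_vec\<close> is
    \<open>\<beta> x y\<close>, which has no \<open>spin_e1\<close> coordinate.\<close>
  have "s = polar q (h x y) u"
    using arg_cong[OF JT1_vec[OF assms, of u], of "\<lambda>t. snd (snd t)"] snd_snd_beta_X0[OF assms]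
    by (simp add: s Q.polar_commute)
  \<comment> \<open>Multiplying \<open>s\<close> times \<open>spin_e1\<close> by \<open>v\<close>
    halves it, hence the factor 2; expanding the same product by (JT1) yields both values of
    \<open>h\<close>, one with a sign from skew symmetry.\<close>
  have "spin_vec (scaleV s v) =
      spin_scale scaleV 2 (spin_mult scaleV q (spin_vec v) (\<beta> ?x ?y))"
    unfolding s using two_neq_zero
    by (simp add: spin_mult_def spin_scale_def spin_vec_def Q.polar_zero)
  also have "\<dots> = \<beta> (x \<cdot> v) ?y + \<beta> ?x (y \<cdot> v)"
    by (rule JT1_doubled)
  also have "\<dots> = spin_vec (h x (y \<cdot> v) - h y (x \<cdot> v))"
    unfolding spin_vec_simps beta_skew[of "x \<cdot> v" ?y]
    using beta_base[OF assms(1) X0_closed[OF assms(2)]] beta_base[OF assms(2) X0_closed[OF assms(1)]]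
    by simp
  finally have "scaleV s v = h x (y \<cdot> v) - h y (x \<cdot> v)"
    by (simp add: spin_vec_def)
  then show ?thesis
    using \<open>s = _\<close> by simp
qed

text \<open>Both sides are the \<open>spin_e0\<close> coordinate of
  \<open>\<beta> (x \<cdot> v) y\<close>, because \<open>u\<close> acts trivially from the
  right.\<close>

lemma polar_h_act:
  assumes "x \<in> X0" and "y \<in> X0"
  shows "polar q (h (x \<cdot> v) y) u = polar q (h x y) v"
  using fst_beta_act[OF assms, of v] fst_beta_act[OF X0_closed[OF assms(1)] assms(2), of u]
  by (simp add: Q.polar_commute)

lemma act_base_inverse:
  assumes "v \<noteq> 0"
  shows "(x \<cdot> v) \<cdot> base_inverse scaleV q u v = x"
proof -
  have "q v \<noteq> 0"
    using anisotropic assms by (auto simp: anisotropic_def)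
  \<comment> \<open>Moving \<open>v\<close> past \<open>u\<close> reduces the action of the
    conjugate of \<open>v\<close> on \<open>x \<cdot> v\<close> to \<open>u\<close>,
    \<open>v\<close>, \<open>v\<close>, \<open>u\<close> applied in turn to \<open>x\<close>, which
    is \<open>q v\<close> times \<open>x\<close>.\<close>
  then show ?thesis
    using act_vec_commute[of v u "x \<cdot> v"]
    by (simp add: base_inverse_def base_conj_def spin_vec_simps act_simps act_diff act_vec_vec
        base_point Q.polar_commute[of v u])
qed

lemma act_theta:
  assumes "x \<in> X0"
  shows "x \<cdot> qa_theta scaleV (\<cdot>) h x v = (x \<cdot> qa_pi scaleV u (\<cdot>) h x) \<cdot> v"
proof -
  let ?x = "spin_vec u \<bullet> x"
  \<comment> \<open>The right action of a value of \<open>h\<close> on \<open>x\<close> is the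
    action of that value of \<open>\<beta>\<close> on \<open>?x\<close>. The identity for the other
    Peirce component can then be applied at \<open>?x\<close>; the two uses of skew symmetry cancel
    in sign.\<close>
  have "x \<cdot> h x (x \<cdot> v) = \<beta> ?x (spin_vec v \<bullet> ?x) \<bullet> ?x"
    by (simp only: beta_base[OF assms X0_closed[OF assms], symmetric])
  also have "\<dots> = - (\<beta> (spin_vec v \<bullet> ?x) ?x \<bullet> ?x)"
    by (simp only: beta_skew[of ?x "spin_vec v \<bullet> ?x"] act_minus)
  also have "\<dots> = - (spin_vec v \<bullet> (spin_vec u \<bullet> (\<beta> x ?x \<bullet> ?x)))"
    using beta_act_X1[OF base_X1[OF assms], of v] by simp
  also have "\<dots> = spin_vec v \<bullet> (spin_vec u \<bullet> (x \<cdot> h x x))"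
    by (simp only: beta_skew[of x ?x] act_minus beta_base[OF assms assms, symmetric] minus_minus)
  finally show ?thesis
    by (simp add: qa_theta_def qa_pi_def spin_vec_simps act_simps)
qed

lemma quadrangular_algebra_X0:
  assumes "(UNIV :: 'x set) \<noteq> {0}"
    and nonzero: "\<forall>x \<in> X0 - {0}. \<beta> (spin_vec u \<bullet> x) x \<noteq> 0"
  shows "quadrangular_algebra scaleV q u scaleX X0 (\<cdot>) h"
proof unfold_locales
  show "qa_pi scaleV u (\<cdot>) h x \<noteq> 0" if "x \<in> X0" "x \<noteq> 0" for x
  proof -
    have "spin_vec (h x x) \<noteq> (0 :: ('k, 'v) spin)"
      using nonzero that beta_base[of x x] by auto
    then have "h x x \<noteq> 0"
      by (auto simp: spin_vec_def zero_prod_def)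
    then show ?thesis
      using two_neq_zero by (simp add: qa_pi_def qa_theta_def)
  qed
next
  show "linear_on scaleX X0 scaleX (\<lambda>x. x \<cdot> v)" for v
    by (simp add: linear_on_def act_simps)
  show "linear_on scaleV UNIV scaleX (\<lambda>v. x \<cdot> v)" for x
    by (simp add: linear_on_def act_simps spin_vec_simps)
  show "linear_on scaleX X0 scaleV (\<lambda>x. h x y)" for y
    by (simp add: linear_on_def act_simps beta_simps spin_vec_part_linear)
  show "linear_on scaleX X0 scaleV (\<lambda>y. h x y)" for x
    by (simp add: linear_on_def beta_simps spin_vec_part_linear)
  show "X0 \<noteq> {0}"
    using assms(1) by (rule X0_nontrivial)
  show "x \<cdot> v \<in> X0" if "x \<in> X0" for x v
    using that by (rule X0_closed)
  show "x \<cdot> u = x" for x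
    by (rule act_base_base)
  show "(x \<cdot> v) \<cdot> base_inverse scaleV q u v = x" if "v \<noteq> 0" for x v
    using that by (rule act_base_inverse)
  show "h x (y \<cdot> v) = h y (x \<cdot> v) + scaleV (polar q (h x y) u) v" if "x \<in> X0" "y \<in> X0" for x y v
    using that by (rule h_act_commute)
  show "polar q (h (x \<cdot> v) y) u = polar q (h x y) v" if "x \<in> X0" "y \<in> X0" for x y v
    using that by (rule polar_h_act)
  show "x \<cdot> qa_theta scaleV (\<cdot>) h x v = (x \<cdot> qa_pi scaleV u (\<cdot>) h x) \<cdot> v" if "x \<in> X0" for x v
    using that by (rule act_theta)
qed (fact char_not_2 anisotropic base_point subspace_X0)+

end

theorem theorem3p7:
  fixes scaleV :: "'k::field \<Rightarrow> 'v::ab_group_add \<Rightarrow> 'v"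
    and q :: "'v \<Rightarrow> 'k"
    and u :: 'v
    and scaleX :: "'k \<Rightarrow> 'x::ab_group_add \<Rightarrow> 'x"
    and act :: "('k, 'v) spin \<Rightarrow> 'x \<Rightarrow> 'x"  (infixr \<open>\<bullet>\<close> 75)
    and \<beta> :: "'x \<Rightarrow> 'x \<Rightarrow> ('k, 'v) spin"
    and \<tau> :: "'x \<Rightarrow> 'x \<Rightarrow> 'x \<Rightarrow> 'x"
    and X0 :: "'x set"
  assumes "CHAR('k) \<noteq> 2" and "CHAR('k) \<noteq> 3"
    and "quadratic_form scaleV q" and "nondegenerate q" and "anisotropic q"
    and "q u = 1"
    and "J_ternary_algebra (spin_scale scaleV) (spin_mult scaleV q) spin_one scaleX (\<bullet>) \<beta> \<tau>"
    and "(UNIV :: 'x set) \<noteq> {0}"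
    and "X0 = {x. spin_e0 \<bullet> x = x}"
    and "\<forall>x \<in> X0 - {0}. \<beta> (spin_vec u \<bullet> x) x \<noteq> 0"
  shows "(\<forall>x\<in>X0. \<forall>v. \<beta> (spin_vec v \<bullet> x) x \<bullet> x
            = spin_vec v \<bullet> (spin_vec u \<bullet> (\<beta> (spin_vec u \<bullet> x) x \<bullet> x)))
       \<and> (\<forall>x\<in>X0. \<forall>y\<in>X0. \<beta> (spin_vec u \<bullet> x) y \<in> range spin_vec)
       \<and> quadrangular_algebra scaleV q u scaleX X0
            (\<lambda>x v. spin_vec v \<bullet> (spin_vec u \<bullet> x))
            (\<lambda>x y. spin_vec_part (\<beta> (spin_vec u \<bullet> x) y))"
proof -
  interpret J_ternary_algebra "spin_scale scaleV" "spin_mult scaleV q" spin_one scaleX "(\<bullet>)" \<beta> \<tau>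
    by fact
  interpret Q: quadratic_form scaleV q
    by fact
  interpret spin_ternary_algebra scaleV q scaleX "(\<bullet>)" \<beta> \<tau> u
    by unfold_locales fact+
  have X0: "x \<in> X0 \<longleftrightarrow> spin_e0 \<bullet> x = x" for x
    by (simp add: \<open>X0 = _\<close>)
  show ?thesis
  proof (intro conjI ballI allI)
    show "\<beta> (spin_vec v \<bullet> x) x \<bullet> x = spin_vec v \<bullet> (spin_vec u \<bullet> (\<beta> (spin_vec u \<bullet> x) x \<bullet> x))"
      if "x \<in> X0" for x v
      using that by (intro beta_act_X0) (simp add: X0)
    show "\<beta> (spin_vec u \<bullet> x) y \<in> range spin_vec" if "x \<in> X0" "y \<in> X0" for x y
      using that by (subst beta_base) (simp_all add: X0)
    show "quadrangular_algebra scaleV q u scaleX X0 (\<lambda>x v. spin_vec v \<bullet> (spin_vec u \<bullet> x))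
        (\<lambda>x y. spin_vec_part (\<beta> (spin_vec u \<bullet> x) y))"
      using assms(8,10) unfolding \<open>X0 = _\<close> by (rule quadrangular_algebra_X0)
  qed
qed

end
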